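(* Let $w$ be an angular weight function on the unit disk $\mathbb{D}$, $w(re^{i\theta})=w(\theta)$, satisfying $$\int_0^{2\pi}w(\theta)\,d\theta<\infty.$$ Then the polynomials are dense in $A^p(\mathbb{D},w\,dA)$ for every $0<p<\infty$.
   Context: $\mathbb{D}=\{z\in\mathbb{C}:|z|<1\}$ and $dA(z)=dx\,dy$ is planar Lebesgue measure. A weight function is a positive integrable function on $\mathbb{D}$; it is called angular if it depends only on the argument of $z$, i.e. $w(re^{i\theta})=w(\theta)$ for $0<r<1$, $0\le\theta<2\pi$, where (by abuse of notation) $w(\theta)$ denotes a positive measurable function on $[0,2\pi)$. For $0<p<\infty$, $A^p(\mathbb{D},w\,dA)$ is the space of analytic functions $f$ on $\mathbb{D}$ with $\|f\|^p_{A^p(\mathbb{D},w\,dA)}=\int_{\mathbb{D}}|f(z)|^p w(z)\,dA(z)<\infty$. Polynomials means analytic polynomials (in $z$, complex coefficients). Density means: for every $f$ in the space and every $\varepsilon>0$ there is a polynomial $Q$ with $\|f-Q\|_{A^p(\mathbb{D},w\,dA)}<\varepsilon$. *)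

theory Defs
  imports "HOL-Analysis.Analysis" "HOL-Computational_Algebra.Polynomial"
begin

abbreviation unit_disk :: "complex set"
  where "unit_disk \<equiv> ball 0 1"

definition weight_function :: "(complex \<Rightarrow> real) \<Rightarrow> bool"
  where "weight_function w \<longleftrightarrow>
    (\<forall>z\<in>unit_disk. 0 < w z) \<and> set_integrable lebesgue unit_disk w"

(* v is the angular profile: w (r e^{i t}) = v t. The value of w at the origin,
   which has no argument, is not constrained. *)
definition angular_profile :: "(complex \<Rightarrow> real) \<Rightarrow> (real \<Rightarrow> real) \<Rightarrow> bool"
  where "angular_profile w v \<longleftrightarrow>
    (\<forall>t\<in>{0..<2*pi}. 0 < v t) \<and>
    set_borel_measurable lebesgue {0..<2*pi} v \<and>
    (\<forall>r\<in>{0<..<1}. \<forall>t\<in>{0..<2*pi}. w (complex_of_real r * cis t) = v t)"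

(* The p-th power of the (quasi-)norm, with value infinity if the integral diverges. *)
definition bergman_integral :: "real \<Rightarrow> (complex \<Rightarrow> real) \<Rightarrow> (complex \<Rightarrow> complex) \<Rightarrow> ennreal"
  where "bergman_integral p w f =
    (\<integral>\<^sup>+z\<in>unit_disk. ennreal (cmod (f z) powr p * w z) \<partial>lebesgue)"

(* The p-th root is written out because powr is not available on ennreal; an infinite
   integral has to be split off, as enn2real maps infinity to 0. *)
definition bergman_norm :: "real \<Rightarrow> (complex \<Rightarrow> real) \<Rightarrow> (complex \<Rightarrow> complex) \<Rightarrow> ennreal"
  where "bergman_norm p w f =
    (if bergman_integral p w f = \<infinity> then \<infinity>
     else ennreal (enn2real (bergman_integral p w f) powr (1 / p)))"

(* Elements are functions on the whole plane; only their values on the disk matter. *)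
definition bergman_space :: "real \<Rightarrow> (complex \<Rightarrow> real) \<Rightarrow> (complex \<Rightarrow> complex) set"
  where "bergman_space p w =
    {f. f holomorphic_on unit_disk \<and> bergman_integral p w f < \<infinity>}"

definition polynomials_dense :: "real \<Rightarrow> (complex \<Rightarrow> real) \<Rightarrow> bool"
  where "polynomials_dense p w \<longleftrightarrow>
    (\<forall>f\<in>bergman_space p w. \<forall>\<epsilon>>0. \<exists>Q :: complex poly.
       bergman_norm p w (\<lambda>z. f z - poly Q z) < ennreal \<epsilon>)"

end

theory Submission
  imports Defs "HOL-Complex_Analysis.Cauchy_Integral_Formula"
begin

text \<open>
  Polynomials approximate an analytic \<open>f\<close> through its dilations \<open>f\<^sub>r(z) = f(rz)\<close> with
  \<open>0 < r < 1\<close>. Such a dilation is analytic on a disk of radius \<open>1/r > 1\<close>, so its Taylor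
  polynomials converge to it uniformly on the unit disk, hence also in the weighted space, since an
  integrable weight gives the disk finite mass. It remains to see that \<open>f\<^sub>r\<close> tends to \<open>f\<close> in the
  weighted space as \<open>r\<close> tends to 1.

  An angular weight satisfies \<open>w(rz) = w(z)\<close>, because \<open>rz\<close> and \<open>z\<close> have the same argument.
  Substituting \<open>rz\<close> for \<open>z\<close> in the norm integral therefore gives
  \<open>\<integral>|f\<^sub>r|^p w \<le> r^(-2) \<integral>|f|^p w\<close>
  (lemma \<open>bergman_integral_dilation_le\<close>): in the limit, the norms of the dilations do not exceed
  the norm of \<open>f\<close>. Since \<open>f\<^sub>r\<close> also converges to \<open>f\<close> pointwise, a theorem of F. Riesz
  (lemma \<open>Lp_convergence_from_norms\<close>) turns this into convergence in norm.

  For \<open>p < 1\<close> the norm is only a quasi-norm, so all estimates are made for the \<open>p\<close>-th powers, with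
  \<open>(a + b)^p \<le> 2^p (a^p + b^p)\<close>, which holds for every positive \<open>p\<close>, in place of the triangle
  inequality.
\<close>

section \<open>Convergence in mean from convergence of norms\<close>

lemma add_powr_le:
  fixes a b p :: real
  assumes "0 \<le> a" "0 \<le> b" "0 < p"
  shows "(a + b) powr p \<le> 2 powr p * (a powr p + b powr p)"
proof -
  have "(a + b) powr p \<le> (2 * max a b) powr p"
    using assms by (intro powr_mono2) auto
  also have "\<dots> = 2 powr p * max a b powr p"
    using assms by (simp add: powr_mult)
  also have "\<dots> \<le> 2 powr p * (a powr p + b powr p)"
    by (intro mult_left_mono) (auto simp: max_def)
  finally show ?thesis .
qed

text \<open>
  Scheffe's lemma, applied to the \<open>p\<close>-th powers, gives convergence of \<open>|F\<^sub>n|^p\<close> to \<open>|f|^p\<close> in mean. With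
  \<open>C = 2^p\<close> one has
  \<open>|F\<^sub>n - f|^p \<le> C (|F\<^sub>n|^p + |f|^p) \<le> C ||F\<^sub>n|^p - |f|^p| + 2 C |f|^p\<close>.
  Hence the part of \<open>|F\<^sub>n - f|^p\<close> above the level \<open>2 C |f|^p\<close> is controlled by Scheffe's lemma, while
  the part below it tends to 0 by dominated convergence.
\<close>

lemma Lp_convergence_from_norms:
  fixes F :: "nat \<Rightarrow> 'a \<Rightarrow> 'b :: {banach, second_countable_topology}"
  assumes p: "0 < p"
    and F [measurable]: "\<And>n. F n \<in> borel_measurable M"
    and f [measurable]: "f \<in> borel_measurable M"
    and F_fin: "\<And>n. (\<integral>\<^sup>+x. norm (F n x) powr p \<partial>M) < \<infinity>"
    and f_fin: "(\<integral>\<^sup>+x. norm (f x) powr p \<partial>M) < \<infinity>"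
    and lim: "AE x in M. (\<lambda>n. F n x) \<longlonglongrightarrow> f x"
    and limsup: "limsup (\<lambda>n. \<integral>\<^sup>+x. norm (F n x) powr p \<partial>M) \<le> (\<integral>\<^sup>+x. norm (f x) powr p \<partial>M)"
  shows "(\<lambda>n. \<integral>\<^sup>+x. norm (F n x - f x) powr p \<partial>M) \<longlonglongrightarrow> 0"
proof -
  define C where "C = (2 :: real) powr p"
  have C: "0 < C" by (simp add: C_def)
  let ?g = "\<lambda>x. norm (f x) powr p" and ?G = "\<lambda>n x. norm (F n x) powr p"
  let ?d = "\<lambda>n x. norm (F n x - f x) powr p"
  have g_lim: "(\<lambda>n. \<integral>\<^sup>+x. norm (?G n x - ?g x) \<partial>M) \<longlonglongrightarrow> 0"
  proof (rule Scheffe_lemma1)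
    show "integrable M (?G n)" for n
      using F_fin[of n] by (simp add: integrable_iff_bounded)
    show "integrable M ?g"
      using f_fin by (simp add: integrable_iff_bounded)
    show "AE x in M. (\<lambda>n. ?G n x) \<longlonglongrightarrow> ?g x"
      using lim by eventually_elim (use p in \<open>auto intro!: tendsto_powr2 tendsto_norm\<close>)
  qed (use limsup in simp)
  (* The part of |F n - f|^p below the integrable level 2 C |f|^p. *)
  have min_lim: "(\<lambda>n. \<integral>\<^sup>+x. min (?d n x) (2 * C * ?g x) \<partial>M) \<longlonglongrightarrow> (\<integral>\<^sup>+x. 0 \<partial>M)"
  proof (rule nn_integral_dominated_convergence[where w = "\<lambda>x. ennreal (2 * C * ?g x)"])
    have "(\<integral>\<^sup>+x. 2 * C * ?g x \<partial>M) = 2 * C * (\<integral>\<^sup>+x. ?g x \<partial>M)"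
      using C by (subst nn_integral_cmult[symmetric]) (auto simp: ennreal_mult)
    also have "\<dots> < \<infinity>"
      using f_fin by (simp add: ennreal_mult_less_top)
    finally show "(\<integral>\<^sup>+x. 2 * C * ?g x \<partial>M) < \<infinity>" .
    show "AE x in M. (\<lambda>n. ennreal (min (?d n x) (2 * C * ?g x))) \<longlonglongrightarrow> 0"
      using lim
    proof eventually_elim
      case (elim x)
      then have "(\<lambda>n. ?d n x) \<longlonglongrightarrow> 0 powr p"
        using p by (intro tendsto_powr2 tendsto_norm_zero) (auto simp: LIM_zero_iff)
      then have "(\<lambda>n. min (?d n x) (2 * C * ?g x)) \<longlonglongrightarrow> min 0 (2 * C * ?g x)"
        using p by (intro tendsto_min) auto
      moreover have "min 0 (2 * C * ?g x) = 0"
        using C by simp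
      ultimately show ?case
        using tendsto_ennrealI by fastforce
    qed
  qed (auto intro!: AE_I2 ennreal_leI)
  have bound: "(\<integral>\<^sup>+x. ?d n x \<partial>M)
      \<le> C * (\<integral>\<^sup>+x. norm (?G n x - ?g x) \<partial>M) + (\<integral>\<^sup>+x. min (?d n x) (2 * C * ?g x) \<partial>M)" for n
  proof -
    have "?d n x \<le> C * norm (?G n x - ?g x) + min (?d n x) (2 * C * ?g x)" for x
    proof -
      have "?d n x \<le> (norm (F n x) + norm (f x)) powr p"
        using p by (intro powr_mono2 norm_triangle_ineq4) auto
      also have "\<dots> \<le> C * (?G n x + ?g x)"
        unfolding C_def using p by (intro add_powr_le) auto
      also have "\<dots> \<le> C * (norm (?G n x - ?g x) + 2 * ?g x)"
        using C by (intro mult_left_mono) auto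
      finally have "?d n x \<le> C * norm (?G n x - ?g x) + 2 * C * ?g x"
        by (simp add: algebra_simps)
      moreover have "0 \<le> C * norm (?G n x - ?g x)"
        using C by simp
      ultimately show ?thesis by linarith
    qed
    then have "(\<integral>\<^sup>+x. ?d n x \<partial>M)
        \<le> (\<integral>\<^sup>+x. ennreal C * ennreal (norm (?G n x - ?g x)) + ennreal (min (?d n x) (2 * C * ?g x)) \<partial>M)"
      using C by (intro nn_integral_mono) (auto simp flip: ennreal_mult ennreal_plus intro!: ennreal_leI)
    then show ?thesis
      by (simp add: nn_integral_add nn_integral_cmult)
  qed
  have "(\<lambda>n. C * (\<integral>\<^sup>+x. norm (?G n x - ?g x) \<partial>M) + (\<integral>\<^sup>+x. min (?d n x) (2 * C * ?g x) \<partial>M))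
      \<longlonglongrightarrow> ennreal C * 0 + 0"
    using g_lim min_lim by (intro tendsto_add ennreal_tendsto_cmult) auto
  then have upper_lim: "(\<lambda>n. C * (\<integral>\<^sup>+x. norm (?G n x - ?g x) \<partial>M) + (\<integral>\<^sup>+x. min (?d n x) (2 * C * ?g x) \<partial>M))
      \<longlonglongrightarrow> 0"
    by simp
  show ?thesis
  proof (rule tendsto_sandwich[OF _ _ tendsto_const upper_lim])
    show "\<forall>\<^sub>F n in sequentially. (\<integral>\<^sup>+x. ?d n x \<partial>M)
        \<le> C * (\<integral>\<^sup>+x. norm (?G n x - ?g x) \<partial>M) + (\<integral>\<^sup>+x. min (?d n x) (2 * C * ?g x) \<partial>M)"
      by (intro always_eventually allI bound)
  qed simp
qed

section \<open>Scaling of Lebesgue measure\<close>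

lemma nn_integral_lebesgue_scale:
  fixes h :: "'a :: euclidean_space \<Rightarrow> ennreal"
  assumes h: "h \<in> borel_measurable lebesgue" and c: "c \<noteq> 0"
  shows "(\<integral>\<^sup>+x. h x \<partial>lebesgue) = ennreal (\<bar>c\<bar> ^ DIM('a)) * (\<integral>\<^sup>+x. h (c *\<^sub>R x) \<partial>lebesgue)"
proof -
  define T where "T = (\<lambda>x::'a. 0 + (\<Sum>j\<in>Basis. (c * (x \<bullet> j)) *\<^sub>R j))"
  have T_eq: "T = (\<lambda>x. c *\<^sub>R x)"
    unfolding T_def scaleR_scaleR[symmetric] scaleR_sum_right[symmetric] euclidean_representation
    by simp
  have T: "T \<in> lebesgue \<rightarrow>\<^sub>M lebesgue"
    unfolding T_def using c by (intro lebesgue_affine_measurable) auto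
  have leb: "lebesgue = density (distr lebesgue lebesgue T) (\<lambda>_. ennreal (\<bar>c\<bar> ^ DIM('a)))"
    using lebesgue_affine_euclidean[where c="\<lambda>_::'a. c" and t=0] c by (simp add: T_def)
  have "(\<integral>\<^sup>+x. h x \<partial>lebesgue) = (\<integral>\<^sup>+x. ennreal (\<bar>c\<bar> ^ DIM('a)) * h x \<partial>distr lebesgue lebesgue T)"
    using h by (subst leb, subst nn_integral_density) auto
  also have "\<dots> = ennreal (\<bar>c\<bar> ^ DIM('a)) * (\<integral>\<^sup>+x. h (T x) \<partial>lebesgue)"
    using h T by (simp add: nn_integral_cmult nn_integral_distr measurable_compose[OF T h])
  finally show ?thesis by (simp add: T_eq)
qed

section \<open>Dilations of holomorphic functions\<close>

text \<open>
  The Taylor series at 0 converges at every point of the larger disk, so its radius of convergence is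
  at least \<open>R\<close>, and a power series converges uniformly on smaller closed disks.
\<close>

lemma Taylor_approximation_on_cball:
  fixes f :: "complex \<Rightarrow> complex"
  assumes f: "f holomorphic_on ball 0 R" and r: "r < R" and e: "0 < e"
  shows "\<exists>Q :: complex poly. \<forall>z\<in>cball 0 r. cmod (f z - poly Q z) < e"
proof -
  define a where "a = (\<lambda>n. (deriv ^^ n) f 0 / fact n)"
  have sums: "(\<lambda>n. a n * z ^ n) sums f z" if "z \<in> ball 0 R" for z
    using holomorphic_power_series[OF f that] by (simp add: a_def)
  have "conv_radius a \<ge> ereal R"
  proof (rule conv_radius_geI_ex)
    fix s assume s: "0 < s" "ereal s < ereal R"
    then show "\<exists>z. norm z = s \<and> summable (\<lambda>n. a n * z ^ n)"
      by (intro exI[of _ "of_real s"]) (auto intro!: sums_summable[OF sums])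
  qed
  then have "ereal r < conv_radius a"
    by (rule less_le_trans[rotated]) (use r in simp)
  then have "uniform_limit (cball 0 r) (\<lambda>n x. \<Sum>i<n. a i * (x - 0) ^ i) (\<lambda>x. \<Sum>i. a i * (x - 0) ^ i) sequentially"
    by (rule powser_uniform_limit)
  from uniform_limitD[OF this e] obtain n where
    n: "\<forall>x\<in>cball 0 r. dist (\<Sum>i<n. a i * x ^ i) (\<Sum>i. a i * x ^ i) < e"
    by (auto simp: eventually_sequentially)
  show ?thesis
  proof (intro exI ballI)
    fix z :: complex assume z: "z \<in> cball 0 r"
    then have "(\<Sum>i. a i * z ^ i) = f z"
      using r by (intro sums_unique[symmetric] sums) auto
    then show "cmod (f z - poly (\<Sum>i<n. monom (a i) i) z) < e"
      using n[rule_format, OF z] by (simp add: poly_sum poly_monom dist_norm norm_minus_commute)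
  qed
qed

lemma dilation_in_unit_disk:
  assumes "z \<in> unit_disk" "0 < r" "r < 1"
  shows "of_real r * z \<in> unit_disk"
proof -
  have "r * cmod z \<le> cmod z"
    using assms by (intro mult_left_le_one_le) auto
  then show ?thesis
    using assms by (simp add: norm_mult)
qed

lemma holomorphic_on_dilation:
  assumes hol: "f holomorphic_on unit_disk" and r: "0 < r" "r < 1"
  shows "(\<lambda>z. f (of_real r * z)) holomorphic_on ball 0 (1 / r)"
  by (rule holomorphic_on_compose_gen[OF _ hol, unfolded o_def])
     (use r in \<open>auto intro!: holomorphic_intros simp: norm_mult field_simps\<close>)

lemma holomorphic_on_dilation_disk:
  assumes "f holomorphic_on unit_disk" "0 < r" "r < 1"
  shows "(\<lambda>z. f (of_real r * z)) holomorphic_on unit_disk"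
proof (rule holomorphic_on_subset[OF holomorphic_on_dilation[OF assms]])
  have "1 < 1 / r"
    using assms by simp
  then show "unit_disk \<subseteq> ball 0 (1 / r)"
    by (intro subset_ball) simp
qed

section \<open>The weighted measure on the disk\<close>

text \<open>
  Putting the weight into the measure makes \<open>bergman_integral\<close> an ordinary \<open>p\<close>-th moment. Restricting
  the space to the disk makes measurable every function that is holomorphic there, whatever its
  values outside.
\<close>

definition disk_measure :: "(complex \<Rightarrow> real) \<Rightarrow> complex measure"
  where "disk_measure w = density (lebesgue_on unit_disk) (\<lambda>z. ennreal (w z))"

lemma weight_measurable:
  assumes "weight_function w"
  shows "w \<in> borel_measurable (lebesgue_on unit_disk)"
  using assms unfolding weight_function_def set_integrable_def
  by (subst borel_measurable_restrict_space_iff) auto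

lemma measurable_disk_measure [simp]:
  "borel_measurable (disk_measure w) = borel_measurable (lebesgue_on unit_disk)"
  unfolding disk_measure_def by (auto simp: measurable_def)

lemma holomorphic_measurable_disk:
  "f holomorphic_on unit_disk \<Longrightarrow> f \<in> borel_measurable (disk_measure w)"
  by (simp add: continuous_imp_measurable_on_sets_lebesgue holomorphic_on_imp_continuous_on)

lemma bergman_integral_disk_measure:
  assumes w: "weight_function w" and f: "f \<in> borel_measurable (disk_measure w)"
  shows "bergman_integral p w f = (\<integral>\<^sup>+z. cmod (f z) powr p \<partial>disk_measure w)"
proof -
  have [measurable]: "w \<in> borel_measurable (lebesgue_on unit_disk)"
    "f \<in> borel_measurable (lebesgue_on unit_disk)"
    using weight_measurable[OF w] f by auto
  have "(\<integral>\<^sup>+z. cmod (f z) powr p \<partial>disk_measure w)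
      = (\<integral>\<^sup>+z. ennreal (w z) * ennreal (cmod (f z) powr p) \<partial>lebesgue_on unit_disk)"
    unfolding disk_measure_def by (rule nn_integral_density) measurable
  also have "\<dots> = (\<integral>\<^sup>+z\<in>unit_disk. ennreal (w z) * ennreal (cmod (f z) powr p) \<partial>lebesgue)"
    by (rule nn_integral_restrict_space) auto
  also have "\<dots> = bergman_integral p w f"
    unfolding bergman_integral_def
    using w by (intro nn_integral_cong)
      (auto simp: indicator_def weight_function_def mult.commute ennreal_mult less_imp_le)
  finally show ?thesis ..
qed

lemma finite_disk_measure:
  assumes w: "weight_function w"
  shows "emeasure (disk_measure w) (space (disk_measure w)) < \<infinity>"
proof -
  have "integrable (lebesgue_on unit_disk) w"
    using w by (simp add: weight_function_def integrable_restrict_space set_integrable_def)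
  then have "(\<integral>\<^sup>+z. norm (w z) \<partial>lebesgue_on unit_disk) < \<infinity>"
    by (simp add: integrable_iff_bounded)
  moreover have "emeasure (disk_measure w) (space (disk_measure w)) = (\<integral>\<^sup>+z. w z \<partial>lebesgue_on unit_disk)"
    unfolding disk_measure_def using weight_measurable[OF w]
    by (subst emeasure_density) (auto intro!: nn_integral_cong simp: indicator_def)
  ultimately show ?thesis
    by (auto elim!: order.strict_trans1[rotated] intro!: nn_integral_mono ennreal_leI)
qed

section \<open>Dilations in the weighted space\<close>

lemma angular_profile_imp_scale_invariant:
  assumes v: "angular_profile w v" and z: "z \<in> unit_disk" "z \<noteq> 0" and r: "0 < r" "r < 1"
  shows "w (of_real r * z) = w z"
proof -
  have z_eq: "of_real (cmod z) * cis (Arg2pi z) = z"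
    using Arg2pi_eq[of z] by (simp add: cis_conv_exp)
  have t: "Arg2pi z \<in> {0..<2*pi}"
    using Arg2pi[of z] by auto
  have w: "w (of_real s * cis (Arg2pi z)) = v (Arg2pi z)" if "0 < s" "s < 1" for s
    using v t that by (auto simp: angular_profile_def)
  have "r * cmod z < 1"
    using dilation_in_unit_disk[OF z(1) r] r by (simp add: norm_mult)
  then have "w (of_real (r * cmod z) * cis (Arg2pi z)) = v (Arg2pi z)"
    using z r by (intro w) auto
  moreover have "w (of_real (cmod z) * cis (Arg2pi z)) = v (Arg2pi z)"
    using z by (intro w) auto
  moreover have "of_real (r * cmod z) * cis (Arg2pi z) = of_real r * z"
    using z_eq by (simp add: mult.assoc)
  ultimately show ?thesis
    by (metis z_eq)
qed

text \<open>
  The integrand at \<open>z\<close> is \<open>|f(rz)|^p w(rz)\<close>, that is, the integrand for \<open>f\<close> taken at \<open>rz\<close>. As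
  \<open>z\<close> runs through the unit disk, \<open>rz\<close> runs through the smaller disk of radius \<open>r\<close>; enlarging
  this to the unit disk gives the inequality, and the factor is the inverse of the
  Jacobian \<open>r\<^sup>2\<close> of a planar dilation.
\<close>

lemma bergman_integral_dilation_le:
  assumes w: "weight_function w" and inv: "\<And>z. z \<in> unit_disk \<Longrightarrow> z \<noteq> 0 \<Longrightarrow> w (of_real r * z) = w z"
    and f: "f \<in> borel_measurable (disk_measure w)" and r: "0 < r" "r < 1"
  shows "bergman_integral p w (\<lambda>z. f (of_real r * z)) \<le> ennreal (1 / r\<^sup>2) * bergman_integral p w f"
proof -
  define h where "h = (\<lambda>z. ennreal (cmod (f z) powr p * w z) * indicator unit_disk z)"
  have [measurable]: "w \<in> borel_measurable (lebesgue_on unit_disk)"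
    "f \<in> borel_measurable (lebesgue_on unit_disk)"
    using weight_measurable[OF w] f by auto
  have h: "h \<in> borel_measurable lebesgue"
    unfolding h_def
    by (subst borel_measurable_restrict_space_iff_ennreal[symmetric]) auto
  have "bergman_integral p w (\<lambda>z. f (of_real r * z)) \<le> (\<integral>\<^sup>+z. h (r *\<^sub>R z) \<partial>lebesgue)"
    unfolding bergman_integral_def
  proof (rule nn_integral_mono_AE)
    (* The invariance of the weight says nothing at the origin, a null set. *)
    have "{0 :: complex} \<in> null_sets lebesgue"
      by (simp add: null_sets_completionI)
    then have "AE z in lebesgue. z \<noteq> (0::complex)"
      by (rule AE_I') auto
    then show "AE z in lebesgue. ennreal (cmod (f (of_real r * z)) powr p * w z) * indicator unit_disk z
        \<le> h (r *\<^sub>R z)"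
    proof eventually_elim
      case (elim z)
      show ?case
      proof (cases "z \<in> unit_disk")
        case True
        then have "of_real r * z \<in> unit_disk"
          using r by (rule dilation_in_unit_disk)
        then show ?thesis
          using True elim inv[OF True elim] by (simp add: h_def scaleR_conv_of_real)
      qed simp
    qed
  qed
  also have "\<dots> = ennreal (1 / r\<^sup>2) * (ennreal (r\<^sup>2) * (\<integral>\<^sup>+z. h (r *\<^sub>R z) \<partial>lebesgue))"
    using r by (simp add: mult.assoc[symmetric] flip: ennreal_mult)
  also have "ennreal (r\<^sup>2) * (\<integral>\<^sup>+z. h (r *\<^sub>R z) \<partial>lebesgue) = (\<integral>\<^sup>+z. h z \<partial>lebesgue)"
    using nn_integral_lebesgue_scale[OF h, of r] r by simp
  also have "\<dots> = bergman_integral p w f"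
    by (simp add: h_def bergman_integral_def)
  finally show ?thesis .
qed

text \<open>
  Along radii increasing to 1 the dilations converge pointwise, and the factor
  \<open>1/r\<^sup>2\<close> tends to 1, which is the bound on the limit superior of the norms that Riesz's theorem asks for.
\<close>

lemma dilation_approximation:
  assumes w: "weight_function w"
    and inv: "\<And>z r. z \<in> unit_disk \<Longrightarrow> z \<noteq> 0 \<Longrightarrow> 0 < r \<Longrightarrow> r < 1 \<Longrightarrow> w (of_real r * z) = w z"
    and f: "f \<in> bergman_space p w" and p: "0 < p" and e: "0 < e"
  shows "\<exists>r. 0 < r \<and> r < 1 \<and> bergman_integral p w (\<lambda>z. f (of_real r * z) - f z) < e"
proof -
  (* The shift by one keeps the first radius positive. *)
  define r where "r = (\<lambda>n. real (Suc n) / real (Suc (Suc n)))"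
  have r: "0 < r n" "r n < 1" for n
    by (auto simp: r_def field_simps)
  have r_lim: "r \<longlonglongrightarrow> 1"
    unfolding r_def by (rule LIMSEQ_Suc[OF LIMSEQ_n_over_Suc_n])
  have hol: "f holomorphic_on unit_disk" and fin: "bergman_integral p w f < \<infinity>"
    using f by (auto simp: bergman_space_def)
  have hol_r: "(\<lambda>z. f (of_real (r n) * z)) holomorphic_on unit_disk" for n
    by (intro holomorphic_on_dilation_disk hol r)
  note meas = holomorphic_measurable_disk[OF hol, where w = w] holomorphic_measurable_disk[OF hol_r, where w = w]
  have le: "bergman_integral p w (\<lambda>z. f (of_real (r n) * z)) \<le> ennreal (1 / (r n)\<^sup>2) * bergman_integral p w f" for n
    using r by (intro bergman_integral_dilation_le w inv meas) auto
  have "(\<lambda>n. \<integral>\<^sup>+z. cmod (f (of_real (r n) * z) - f z) powr p \<partial>disk_measure w) \<longlonglongrightarrow> 0"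
  proof (rule Lp_convergence_from_norms[OF p meas(2) meas(1)])
    show "(\<integral>\<^sup>+z. cmod (f (of_real (r n) * z)) powr p \<partial>disk_measure w) < \<infinity>" for n
      using le[of n] fin
      by (simp add: bergman_integral_disk_measure[OF w meas(2), symmetric] ennreal_mult_less_top order.strict_trans1)
    show "(\<integral>\<^sup>+z. cmod (f z) powr p \<partial>disk_measure w) < \<infinity>"
      using fin by (simp add: bergman_integral_disk_measure[OF w meas(1)])
    show "AE z in disk_measure w. (\<lambda>n. f (of_real (r n) * z)) \<longlonglongrightarrow> f z"
    proof (rule AE_I2)
      fix z assume "z \<in> space (disk_measure w)"
      then have z: "z \<in> unit_disk"
        by (simp add: disk_measure_def space_restrict_space)
      have "(\<lambda>n. of_real (r n) * z) \<longlonglongrightarrow> of_real 1 * z"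
        by (intro tendsto_intros r_lim)
      then show "(\<lambda>n. f (of_real (r n) * z)) \<longlonglongrightarrow> f z"
        using z by (intro continuous_on_tendsto_compose[OF holomorphic_on_imp_continuous_on[OF hol]]
            always_eventually allI dilation_in_unit_disk r) auto
    qed
    have "(\<lambda>n. 1 / (r n)\<^sup>2) \<longlonglongrightarrow> 1 / 1\<^sup>2"
      by (intro tendsto_intros r_lim) auto
    then have "(\<lambda>n. ennreal (1 / (r n)\<^sup>2) * bergman_integral p w f) \<longlonglongrightarrow> 1 * bergman_integral p w f"
      using fin by (intro tendsto_mult_ennreal tendsto_const) (auto dest: tendsto_ennrealI)
    then have "limsup (\<lambda>n. ennreal (1 / (r n)\<^sup>2) * bergman_integral p w f) = bergman_integral p w f"
      by (simp add: lim_imp_Limsup)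
    moreover have "limsup (\<lambda>n. bergman_integral p w (\<lambda>z. f (of_real (r n) * z)))
        \<le> limsup (\<lambda>n. ennreal (1 / (r n)\<^sup>2) * bergman_integral p w f)"
      by (intro Limsup_mono always_eventually allI le)
    ultimately show "limsup (\<lambda>n. \<integral>\<^sup>+z. cmod (f (of_real (r n) * z)) powr p \<partial>disk_measure w)
        \<le> (\<integral>\<^sup>+z. cmod (f z) powr p \<partial>disk_measure w)"
      by (simp add: bergman_integral_disk_measure[OF w meas(2), symmetric]
          bergman_integral_disk_measure[OF w meas(1), symmetric])
  qed
  from order_tendstoD(2)[OF this e] obtain n where
    n: "(\<integral>\<^sup>+z. cmod (f (of_real (r n) * z) - f z) powr p \<partial>disk_measure w) < e"
    by (auto simp: eventually_sequentially)
  have "bergman_integral p w (\<lambda>z. f (of_real (r n) * z) - f z) < e"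
    using n meas by (subst bergman_integral_disk_measure[OF w]) auto
  then show ?thesis
    using r by blast
qed

text \<open>
  The error of a Taylor polynomial is uniformly small on the closed unit disk, and the weighted
  measure of the disk is finite.
\<close>

lemma polynomial_approximation_of_dilation:
  assumes w: "weight_function w" and hol: "f holomorphic_on unit_disk"
    and p: "0 < p" and r: "0 < r" "r < 1" and e: "0 < (e :: real)"
  shows "\<exists>Q. bergman_integral p w (\<lambda>z. f (of_real r * z) - poly Q z) < e"
proof -
  define m where "m = enn2real (emeasure (disk_measure w) (space (disk_measure w)))"
  have m: "emeasure (disk_measure w) (space (disk_measure w)) = ennreal m" "0 \<le> m"
    using finite_disk_measure[OF w] by (auto simp: m_def)
  (* A uniform error d costs at most d^p m = e m / (m + 1); adding 1 to the mass m makes this strictly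
     less than e and also covers m = 0. *)
  define d where "d = (e / (m + 1)) powr (1 / p)"
  have d: "0 < d" "d powr p = e / (m + 1)"
    using e p m by (auto simp: d_def powr_powr)
  note g = holomorphic_on_dilation[OF hol r]
  have "1 < 1 / r"
    using r by simp
  then obtain Q where Q: "\<forall>z\<in>cball 0 1. cmod (f (of_real r * z) - poly Q z) < d"
    using Taylor_approximation_on_cball[OF g _ d(1)] by blast
  have "(\<lambda>z. f (of_real r * z) - poly Q z) holomorphic_on unit_disk"
    by (intro holomorphic_intros holomorphic_on_dilation_disk hol r)
  then have "bergman_integral p w (\<lambda>z. f (of_real r * z) - poly Q z)
      = (\<integral>\<^sup>+z. cmod (f (of_real r * z) - poly Q z) powr p \<partial>disk_measure w)"
    by (intro bergman_integral_disk_measure[OF w] holomorphic_measurable_disk)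
  also have "\<dots> \<le> (\<integral>\<^sup>+z. ennreal (d powr p) \<partial>disk_measure w)"
  proof (intro nn_integral_mono ennreal_leI powr_mono2)
    fix z assume "z \<in> space (disk_measure w)"
    then show "cmod (f (of_real r * z) - poly Q z) \<le> d"
      using Q by (auto simp: disk_measure_def space_restrict_space intro!: less_imp_le)
  qed (use p in auto)
  also have "\<dots> = ennreal (e / (m + 1) * m)"
    using m e by (simp only: d nn_integral_const m(1)) (intro ennreal_mult[symmetric]; simp)
  also have "\<dots> < ennreal e"
  proof (rule ennreal_lessI)
    show "e / (m + 1) * m < e"
      using m e by (simp add: divide_simps)
  qed (fact e)
  finally show ?thesis by blast
qed

section \<open>Density of polynomials\<close>

lemma bergman_integral_add_le:
  assumes w: "weight_function w" and p: "0 < p"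
    and f: "f \<in> borel_measurable (disk_measure w)" and g: "g \<in> borel_measurable (disk_measure w)"
  shows "bergman_integral p w (\<lambda>z. f z + g z)
    \<le> ennreal (2 powr p) * (bergman_integral p w f + bergman_integral p w g)"
proof -
  have "(\<integral>\<^sup>+z. cmod (f z + g z) powr p \<partial>disk_measure w)
      \<le> (\<integral>\<^sup>+z. ennreal (2 powr p) * (ennreal (cmod (f z) powr p) + ennreal (cmod (g z) powr p)) \<partial>disk_measure w)"
  proof (rule nn_integral_mono)
    fix z
    have "cmod (f z + g z) powr p \<le> (cmod (f z) + cmod (g z)) powr p"
      using p by (intro powr_mono2 norm_triangle_ineq) auto
    also have "\<dots> \<le> 2 powr p * (cmod (f z) powr p + cmod (g z) powr p)"
      using p by (intro add_powr_le) auto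
    finally show "ennreal (cmod (f z + g z) powr p)
        \<le> ennreal (2 powr p) * (ennreal (cmod (f z) powr p) + ennreal (cmod (g z) powr p))"
      by (simp flip: ennreal_plus ennreal_mult add: ennreal_leI)
  qed
  also have "\<dots> = ennreal (2 powr p) * ((\<integral>\<^sup>+z. cmod (f z) powr p \<partial>disk_measure w)
      + (\<integral>\<^sup>+z. cmod (g z) powr p \<partial>disk_measure w))"
    using f g by (simp add: nn_integral_cmult nn_integral_add)
  finally show ?thesis
    using f g by (simp add: bergman_integral_disk_measure[OF w])
qed

lemma bergman_norm_less:
  assumes "bergman_integral p w f < ennreal (\<epsilon> powr p)" "0 < p" "0 < \<epsilon>"
  shows "bergman_norm p w f < ennreal \<epsilon>"
proof -
  have fin: "bergman_integral p w f \<noteq> \<infinity>"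
    using assms(1) by auto
  have "enn2real (bergman_integral p w f) < \<epsilon> powr p"
    using assms(1) fin by (cases "bergman_integral p w f") (auto simp: ennreal_less_iff)
  then have "enn2real (bergman_integral p w f) powr (1 / p) < (\<epsilon> powr p) powr (1 / p)"
    using assms by (intro powr_less_mono2) auto
  then show ?thesis
    using fin assms by (auto simp: bergman_norm_def powr_powr intro!: ennreal_lessI)
qed

theorem theorem2p9:
  fixes w :: "complex \<Rightarrow> real" and v :: "real \<Rightarrow> real"
  assumes "weight_function w"
    and "angular_profile w v"
    and "(\<integral>\<^sup>+\<theta>\<in>{0..<2*pi}. ennreal (v \<theta>) \<partial>lebesgue) < \<infinity>"
  shows "\<forall>p::real. 0 < p \<longrightarrow> polynomials_dense p w"
  unfolding polynomials_dense_def
proof (intro allI impI ballI)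
  fix p f and \<epsilon> :: real
  assume p: "0 < p" and f: "f \<in> bergman_space p w" and \<epsilon>: "0 < \<epsilon>"
  note w = assms(1)
  have hol: "f holomorphic_on unit_disk"
    using f by (simp add: bergman_space_def)
  (* Two errors below \<delta>, added at the cost of a factor 2^p, stay below \<epsilon>^p. *)
  define \<delta> where "\<delta> = \<epsilon> powr p / (2 * 2 powr p)"
  have \<delta>: "0 < \<delta>"
    using \<epsilon> by (simp add: \<delta>_def)
  obtain r where r: "0 < r" "r < 1"
    and fr: "bergman_integral p w (\<lambda>z. f (of_real r * z) - f z) < ennreal \<delta>"
    using dilation_approximation[OF w angular_profile_imp_scale_invariant[OF assms(2)] f p, of "ennreal \<delta>"] \<delta>
    by auto
  obtain Q where Q: "bergman_integral p w (\<lambda>z. f (of_real r * z) - poly Q z) < ennreal \<delta>"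
    using polynomial_approximation_of_dilation[OF w hol p r \<delta>] by blast
  have "bergman_integral p w (\<lambda>z. f z - poly Q z)
      = bergman_integral p w (\<lambda>z. (f z - f (of_real r * z)) + (f (of_real r * z) - poly Q z))"
    by simp
  also have "\<dots> \<le> ennreal (2 powr p) * (bergman_integral p w (\<lambda>z. f z - f (of_real r * z))
      + bergman_integral p w (\<lambda>z. f (of_real r * z) - poly Q z))"
    by (intro bergman_integral_add_le w p holomorphic_measurable_disk holomorphic_intros
        holomorphic_on_dilation_disk hol r)
  also have "\<dots> < ennreal (2 powr p) * (ennreal \<delta> + ennreal \<delta>)"
    using fr Q by (intro ennreal_mult_strict_left_mono add_strict_mono)
      (auto simp: bergman_integral_def norm_minus_commute)
  also have "\<dots> = ennreal (\<epsilon> powr p)"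
    using \<delta> by (simp add: \<delta>_def flip: ennreal_plus ennreal_mult)
  finally show "\<exists>Q. bergman_norm p w (\<lambda>z. f z - poly Q z) < ennreal \<epsilon>"
    using bergman_norm_less p \<epsilon> by blast
qed

end
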